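(* There exists a simple $4$-$(16,8,45)$ design.
   Context: A $t$-$(v,k,\lambda)$ design consists of a $v$-element set $P$ of points together with a collection $B$ of $k$-element subsets of $P$ (called blocks) such that every $t$-element subset of $P$ is contained in exactly $\lambda$ blocks. The design is simple if $B$ is a set, i.e. contains no repeated blocks. *)

theory Defs
  imports "HOL-Library.Multiset"
begin

text \<open>A block collection is a multiset, so that repeated blocks are possible and
  counted with multiplicity in a general design.\<close>

definition t_design :: "nat \<Rightarrow> nat \<Rightarrow> nat \<Rightarrow> nat \<Rightarrow> 'a set \<Rightarrow> 'a set multiset \<Rightarrow> bool" where
  "t_design t v k l P B \<longleftrightarrow>
     finite P \<and> card P = v \<and>
     (\<forall>b \<in># B. b \<subseteq> P \<and> card b = k) \<and>
     (\<forall>T. T \<subseteq> P \<and> card T = t \<longrightarrow> size {#b \<in># B. T \<subseteq> b#} = l)"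

definition simple_blocks :: "'a set multiset \<Rightarrow> bool" where
  "simple_blocks B \<longleftrightarrow> (\<forall>b \<in># B. count B b = 1)"

end

theory Submission
  imports Defs
begin

text \<open>
  The design was found with the method of Kramer and Mesner. Prescribe on the points
  \<open>0, \<dots>, 15\<close> the group of order 156 generated by the maps \<open>x \<mapsto> x + 1\<close> modulo 13, fixing 13, 14
  and 15, and \<open>x \<mapsto> 2 x\<close> modulo 13, permuting 13, 14, 15 cyclically. Eleven of its orbits on
  8-subsets, with 1170 blocks in all, form a design. To verify this, store the incidence vectors
  of the blocks in a binary trie and decide for one point after the other whether it belongs to
  the 4-subset: if it does, only the subtrie of the blocks through that point is kept, otherwise
  the two subtries are merged. This treats all 1820 4-subsets in one recursion.
\<close>

section \<open>Incidence vectors\<close>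

definition support :: "bool list \<Rightarrow> nat set" where
  "support x = {i. i < length x \<and> x ! i}"

text \<open>Every recursion splits off coordinate 0 and renumbers the others down by one, so what
  remains of \<open>S\<close> is its preimage under \<open>Suc\<close>.\<close>

lemma subset_support_Cons:
  "S \<subseteq> support (a # x) \<longleftrightarrow> (0 \<in> S \<longrightarrow> a) \<and> Suc -` S \<subseteq> support x"
proof -
  have "i \<in> support (a # x) \<longleftrightarrow> (case i of 0 \<Rightarrow> a | Suc j \<Rightarrow> j \<in> support x)" for i
    by (cases i) (simp_all add: support_def)
  then show ?thesis
    by (auto simp: subset_eq split: nat.splits)
qed

lemma support_Nil [simp]: "support [] = {}"
  by (simp add: support_def)

lemma vimage_Suc_support_Cons [simp]: "Suc -` support (a # x) = support x"
  by (auto simp: support_def)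

lemma finite_support [simp]: "finite (support x)"
  by (simp add: support_def)

lemma card_vimage_Suc:
  assumes "finite S"
  shows "card S = card (Suc -` S) + (if 0 \<in> S then 1 else 0)"
proof -
  have S: "S = (if 0 \<in> S then {0} else {}) \<union> Suc ` (Suc -` S)"
  proof (rule set_eqI)
    fix i
    show "i \<in> S \<longleftrightarrow> i \<in> (if 0 \<in> S then {0} else {}) \<union> Suc ` (Suc -` S)"
      by (cases i) auto
  qed
  have "finite (Suc -` S)"
    using assms by (simp add: finite_vimageI)
  moreover have "card (Suc ` (Suc -` S)) = card (Suc -` S)"
    by (rule card_image) simp
  ultimately have "card ((if 0 \<in> S then {0} else {}) \<union> Suc ` (Suc -` S)) =
      card (Suc -` S) + (if 0 \<in> S then 1 else 0)"
    by (simp add: card_insert_if image_iff del: image_vimage_eq)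
  then show ?thesis
    by (simp only: S[symmetric])
qed

lemma card_support_Cons:
  "card (support (a # x)) = card (support x) + (if a then 1 else 0)"
proof -
  have "0 \<in> support (a # x) \<longleftrightarrow> a"
    by (simp add: support_def)
  then show ?thesis
    using card_vimage_Suc[of "support (a # x)"] by simp
qed

lemma inj_on_support: "inj_on support {x. length x = n}"
proof (rule inj_onI)
  fix x y :: "bool list"
  assume len: "x \<in> {x. length x = n}" "y \<in> {x. length x = n}" and eq: "support x = support y"
  show "x = y"
  proof (rule nth_equalityI)
    show "length x = length y" using len by simp
    fix i assume "i < length x"
    then show "x ! i = y ! i" using eq len by (auto simp: support_def set_eq_iff)
  qed
qed

section \<open>Multisets of vectors as binary tries\<close>

text \<open>The number at a node is the multiplicity of the vector that ends there.\<close>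

datatype trie = Empty | Node nat trie trie

primrec vectors :: "trie \<Rightarrow> bool list multiset" where
  "vectors Empty = {#}"
| "vectors (Node m f g) =
     replicate_mset m [] + image_mset (Cons False) (vectors f) + image_mset (Cons True) (vectors g)"

primrec total :: "trie \<Rightarrow> nat" where
  "total Empty = 0"
| "total (Node m f g) = m + total f + total g"

text \<open>Vectors that agree on the remaining points share one node, so tries shrink as points are
  decided, however many blocks they count.\<close>

fun merge :: "trie \<Rightarrow> trie \<Rightarrow> trie" where
  "merge Empty s = s"
| "merge (Node m f g) Empty = Node m f g"
| "merge (Node m f g) (Node n f' g') = Node (m + n) (merge f f') (merge g g')"

fun add_vector :: "bool list \<Rightarrow> trie \<Rightarrow> trie" where
  "add_vector [] Empty = Node 1 Empty Empty"
| "add_vector [] (Node m f g) = Node (Suc m) f g"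
| "add_vector (False # x) Empty = Node 0 (add_vector x Empty) Empty"
| "add_vector (False # x) (Node m f g) = Node m (add_vector x f) g"
| "add_vector (True # x) Empty = Node 0 Empty (add_vector x Empty)"
| "add_vector (True # x) (Node m f g) = Node m f (add_vector x g)"

lemma size_vectors [simp]: "size (vectors s) = total s"
  by (induction s) auto

lemma vectors_merge: "vectors (merge s s') = vectors s + vectors s'"
proof -
  have "replicate_mset (m + n) x = replicate_mset m x + replicate_mset n x" for m n and x :: "bool list"
    by (simp add: multiset_eq_iff)
  then show ?thesis
    by (induction s s' rule: merge.induct) simp_all
qed

text \<open>Vectors ending at the node itself have empty support and cannot cover a nonempty
  \<open>S\<close>. If 0 is not in \<open>S\<close>, the first coordinate is free and both subtries
  count.\<close>

lemma size_filter_vectors_Node: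
  assumes "S \<noteq> {}"
  shows "size {#x \<in># vectors (Node m f g). S \<subseteq> support x#} =
    (if 0 \<in> S then size {#x \<in># vectors g. Suc -` S \<subseteq> support x#}
     else size {#x \<in># vectors (merge f g). Suc -` S \<subseteq> support x#})"
proof -
  have "{#x \<in># replicate_mset m []. S \<subseteq> support x#} = {#}"
    using assms by (induction m) auto
  then show ?thesis
    by (simp add: filter_mset_image_mset subset_support_Cons vectors_merge)
qed

section \<open>Checking the design property\<close>

text \<open>Only a positive answer is meaningful: rejecting \<open>Empty\<close> is a cautious
  default, wrong for \<open>l = 0\<close>. With points still to choose but none left, the claim is
  vacuous.\<close>

fun covers_uniformly :: "nat \<Rightarrow> nat \<Rightarrow> nat \<Rightarrow> trie \<Rightarrow> bool" where
  "covers_uniformly l 0 n s \<longleftrightarrow> total s = l"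
| "covers_uniformly l (Suc t) 0 s \<longleftrightarrow> True"
| "covers_uniformly l (Suc t) (Suc n) Empty \<longleftrightarrow> False"
| "covers_uniformly l (Suc t) (Suc n) (Node m f g) \<longleftrightarrow>
     covers_uniformly l (Suc t) n (merge f g) \<and> covers_uniformly l t n g"

lemma size_filter_vectors_if_covers_uniformly:
  assumes "covers_uniformly l t n s" and "S \<subseteq> {..<n}" and "card S = t"
  shows "size {#x \<in># vectors s. S \<subseteq> support x#} = l"
  using assms
proof (induction l t n s arbitrary: S rule: covers_uniformly.induct)
  case (1 l n s)
  then have "S = {}" by (simp add: finite_subset[OF "1.prems"(2)])
  then show ?case using 1 by simp
next
  case (4 l t n m f g)
  have fin: "finite S" using "4.prems"(2) by (rule finite_subset) simp
  have ne: "S \<noteq> {}" using "4.prems"(3) by auto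
  have sub: "Suc -` S \<subseteq> {..<n}" using "4.prems"(2) by auto
  have "card (Suc -` S) = (if 0 \<in> S then t else Suc t)"
    using card_vimage_Suc[OF fin] "4.prems"(3) by (simp split: if_splits)
  then show ?case
    using "4.IH" "4.prems"(1) sub by (simp add: size_filter_vectors_Node[OF ne] del: vectors.simps)
qed simp_all

text \<open>Equal vectors end at the same node, so the absence of repeated blocks becomes a local
  condition on the multiplicities at depth \<open>v\<close>.\<close>

fun simple_uniform :: "nat \<Rightarrow> nat \<Rightarrow> trie \<Rightarrow> bool" where
  "simple_uniform v k Empty \<longleftrightarrow> True"
| "simple_uniform 0 0 (Node m f g) \<longleftrightarrow> m = 1 \<and> f = Empty \<and> g = Empty"
| "simple_uniform 0 (Suc k) (Node m f g) \<longleftrightarrow> False"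
| "simple_uniform (Suc v) 0 (Node m f g) \<longleftrightarrow> m = 0 \<and> simple_uniform v 0 f \<and> g = Empty"
| "simple_uniform (Suc v) (Suc k) (Node m f g) \<longleftrightarrow>
     m = 0 \<and> simple_uniform v (Suc k) f \<and> simple_uniform v k g"

lemma count_image_Cons:
  "count (image_mset (Cons a) M) (b # x) = (if a = b then count M x else 0)"
  by (induction M) auto

lemma vectors_if_simple_uniform:
  assumes "simple_uniform v k s" and "x \<in># vectors s"
  shows "length x = v \<and> card (support x) = k \<and> count (vectors s) x = 1"
  using assms
  by (induction v k s arbitrary: x rule: simple_uniform.induct)
    (auto simp: card_support_Cons count_image_Cons simp del: card_0_eq card_eq_0_iff)

definition design_check :: "nat \<Rightarrow> nat \<Rightarrow> nat \<Rightarrow> nat \<Rightarrow> trie \<Rightarrow> bool" where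
  "design_check t v k l s \<longleftrightarrow> simple_uniform v k s \<and> covers_uniformly l t v s"

lemma simple_design_if_design_check:
  assumes "design_check t v k l s"
  defines "B \<equiv> image_mset support (vectors s)"
  shows "t_design t v k l {..<v} B" and "simple_blocks B"
proof -
  have uni: "length x = v" "card (support x) = k" "count (vectors s) x = 1"
    if "x \<in># vectors s" for x
    using assms(1) that vectors_if_simple_uniform by (auto simp: design_check_def)
  have cov: "covers_uniformly l t v s"
    using assms(1) by (simp add: design_check_def)
  have "size {#b \<in># B. T \<subseteq> b#} = l" if "T \<subseteq> {..<v}" "card T = t" for T
    using size_filter_vectors_if_covers_uniformly[OF cov that]
    by (simp add: B_def filter_mset_image_mset)
  moreover have "\<forall>b \<in># B. b \<subseteq> {..<v} \<and> card b = k"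
    using uni by (auto simp: B_def) (auto simp: support_def)
  ultimately show "t_design t v k l {..<v} B"
    by (simp add: t_design_def)
  have "count B (support x) = 1" if x: "x \<in># vectors s" for x
  proof -
    \<comment> \<open>All vectors have length \<open>v\<close>, where \<open>support\<close> is
      injective, so multiplicities pass from vectors to blocks.\<close>
    have "support -` {support x} \<inter> set_mset (vectors s) = {x}"
      using x uni(1) inj_on_support[of v] by (auto simp: inj_on_def)
    then show ?thesis
      using uni(3)[OF x] by (simp add: B_def count_image_mset)
  qed
  then show "simple_blocks B"
    by (auto simp: simple_blocks_def B_def)
qed

section \<open>The blocks\<close>

fun iterates :: "('a \<Rightarrow> 'a) \<Rightarrow> nat \<Rightarrow> 'a \<Rightarrow> 'a list" where
  "iterates f 0 x = []"
| "iterates f (Suc n) x = x # iterates f n (f x)"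

definition multiplier :: "nat \<Rightarrow> nat" where
  "multiplier x = (if x < 13 then 2 * x mod 13 else if x < 15 then Suc x else 13)"

text \<open>The number paired with a base block is the number of translation classes in its orbit; the
  first so many powers of the multiplier represent these classes.\<close>

definition base_blocks :: "(nat \<times> nat list) list" where
  "base_blocks = [
    ( 6, [0, 1, 2, 3, 4, 5, 6, 7]),
    ( 3, [0, 1, 2, 3, 4, 5, 8, 10]),
    (12, [0, 1, 2, 3, 4, 6, 7, 15]),
    (12, [0, 1, 2, 3, 4, 6, 9, 13]),
    ( 6, [0, 1, 2, 3, 4, 6, 11, 14]),
    (12, [0, 1, 2, 3, 4, 8, 14, 15]),
    ( 6, [0, 1, 2, 3, 4, 13, 14, 15]),
    (12, [0, 1, 2, 3, 5, 6, 13, 14]),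
    ( 6, [0, 1, 2, 3, 6, 8, 10, 13]),
    (12, [0, 1, 2, 4, 5, 7, 13, 15]),
    ( 3, [0, 1, 2, 6, 9, 13, 14, 15])]"

definition translation_classes :: "nat list list" where
  "translation_classes =
     concat (map (\<lambda>(m, b). iterates (map multiplier) m b) base_blocks)"

definition incidence :: "nat list \<Rightarrow> nat list \<Rightarrow> bool list" where
  "incidence ps b = map (\<lambda>p. p \<in> set b) ps"

text \<open>On the 13 cyclic coordinates, \<open>rotate1\<close> is the translation by -1 modulo 13;
  \<open>y\<close> holds the coordinates of the fixed points.\<close>

fun translates :: "nat \<Rightarrow> bool list \<Rightarrow> bool list \<Rightarrow> bool list list" where
  "translates 0 x y = []"
| "translates (Suc n) x y = (x @ y) # translates n (rotate1 x) y"

definition develop :: "nat list \<Rightarrow> bool list list" where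
  "develop b = translates 13 (incidence [0..<13] b) (incidence [13..<16] b)"

definition blocks :: "bool list list" where
  "blocks = concat (map develop translation_classes)"

text \<open>A closed computation, carried out by rewriting with the code equations; it also confirms
  that the generated blocks are distinct.\<close>

lemma design_check_blocks: "design_check 4 16 8 45 (fold add_vector blocks Empty)"
  by code_simp

theorem theorem7:
  "\<exists>(P :: nat set) (B :: nat set multiset). t_design 4 16 8 45 P B \<and> simple_blocks B"
  using simple_design_if_design_check[OF design_check_blocks] by blast

end
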